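(* Let $T\in\mathbb{N}$, $m\in\mathbb{N}$ and $d=2^m$. Let $\mathcal{A}$ be an action set consisting of $k$ distinct length-$m$ strings of single-qubit Pauli observables. Then for any policy $\pi$ there exists an environment $\rho\in\mathcal{S}_d$ such that $$\mathbb{E}_{\rho,\pi}\big[R_T(\mathcal{A},\rho,\pi)\big]\ge\frac{3}{100}\sqrt{(k-1)T}$$ whenever $T\ge2(k-1)$.
   Context: A length-$m$ string of single-qubit Pauli observables is an operator $P_1\otimes\cdots\otimes P_m$ on $(\mathbb{C}^2)^{\otimes m}$ with each $P_j\in\{\sigma_x,\sigma_y,\sigma_z\}$ (Pauli matrices). $\mathcal{S}_d$ is the set of density matrices on $\mathbb{C}^d$. Discrete multi-armed quantum bandit with finite action set $\mathcal{A}=\{O_1,\dots,O_k\}$ of observables: in each round $t=1,\dots,T$ the learner chooses $A_t\in[k]$ according to a policy $\pi=(\pi_t)$ (distributions on $[k]$ conditioned on past actions and rewards), measures a fresh copy of $\rho$ in the eigenbasis of $O_{A_t}$ and receives the eigenvalue outcome as reward (Born rule). Regret $R_T(\mathcal{A},\rho,\pi)=\sum_{t=1}^T(\max_{O\in\mathcal{A}}\mathrm{Tr}(\rho O)-\mathrm{Tr}(\rho O_{A_t}))$; $\mathbb{E}_{\rho,\pi}$ is expectation over the induced process. *)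

theory Defs
  imports "HOL-Probability.Probability" "Jordan_Normal_Form.Matrix"
begin

definition trace_mat :: "complex mat \<Rightarrow> complex" where
  "trace_mat A = (\<Sum>i<dim_row A. A $$ (i, i))"

definition adjoint_mat :: "complex mat \<Rightarrow> complex mat" where
  "adjoint_mat A = mat (dim_col A) (dim_row A) (\<lambda>(i, j). cnj (A $$ (j, i)))"

definition hermitian_mat :: "complex mat \<Rightarrow> bool" where
  "hermitian_mat A \<longleftrightarrow> adjoint_mat A = A"

definition kron_mat :: "complex mat \<Rightarrow> complex mat \<Rightarrow> complex mat" where
  "kron_mat A B = mat (dim_row A * dim_row B) (dim_col A * dim_col B)
     (\<lambda>(i, j). A $$ (i div dim_row B, j div dim_col B) * B $$ (i mod dim_row B, j mod dim_col B))"

definition density_matrix :: "nat \<Rightarrow> complex mat \<Rightarrow> bool" where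
  "density_matrix d \<rho> \<longleftrightarrow> \<rho> \<in> carrier_mat d d \<and> hermitian_mat \<rho>
     \<and> (\<forall>v \<in> carrier_vec d. 0 \<le> Re ((\<rho> *\<^sub>v v) \<bullet>c v))
     \<and> trace_mat \<rho> = 1"

datatype pauli = PX | PY | PZ

definition pauli_mat :: "pauli \<Rightarrow> complex mat" where
  "pauli_mat P = (case P of
      PX \<Rightarrow> mat_of_rows_list 2 [[0, 1], [1, 0]]
    | PY \<Rightarrow> mat_of_rows_list 2 [[0, -\<i>], [\<i>, 0]]
    | PZ \<Rightarrow> mat_of_rows_list 2 [[1, 0], [0, -1]])"

definition pauli_string :: "pauli list \<Rightarrow> complex mat" where
  "pauli_string ps = foldr (\<lambda>P M. kron_mat (pauli_mat P) M) ps (1\<^sub>m 1)"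

definition eig_proj :: "complex mat \<Rightarrow> real \<Rightarrow> complex mat" where
  "eig_proj Obs lam = (THE P. P \<in> carrier_mat (dim_row Obs) (dim_row Obs) \<and> P * P = P \<and> hermitian_mat P
      \<and> (\<forall>v \<in> carrier_vec (dim_row Obs). P *\<^sub>v v = v \<longleftrightarrow> Obs *\<^sub>v v = complex_of_real lam \<cdot>\<^sub>v v))"

definition is_eigenvalue :: "complex mat \<Rightarrow> real \<Rightarrow> bool" where
  "is_eigenvalue Obs lam \<longleftrightarrow> (\<exists>v \<in> carrier_vec (dim_row Obs). v \<noteq> 0\<^sub>v (dim_row Obs)
       \<and> Obs *\<^sub>v v = complex_of_real lam \<cdot>\<^sub>v v)"

text \<open>Outcome distribution when measuring state rho in the eigenbasis of Obs
  (outcome = eigenvalue, Born rule).\<close>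
definition reward_pmf :: "complex mat \<Rightarrow> complex mat \<Rightarrow> real pmf" where
  "reward_pmf \<rho> Obs = embed_pmf (\<lambda>r. if is_eigenvalue Obs r then Re (trace_mat (\<rho> * eig_proj Obs r)) else 0)"

text \<open>A policy maps a round index t (0-based) and the history of past
  (action, reward) pairs to a distribution over actions. The distribution of
  the history after T rounds:\<close>
primrec hist_pmf :: "(nat \<Rightarrow> complex mat) \<Rightarrow> complex mat
    \<Rightarrow> (nat \<Rightarrow> (nat \<times> real) list \<Rightarrow> nat pmf) \<Rightarrow> nat \<Rightarrow> (nat \<times> real) list pmf" where
  "hist_pmf Obs \<rho> \<pi> 0 = return_pmf []"
| "hist_pmf Obs \<rho> \<pi> (Suc t) = bind_pmf (hist_pmf Obs \<rho> \<pi> t) (\<lambda>h.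
      bind_pmf (\<pi> t h) (\<lambda>a. map_pmf (\<lambda>r. h @ [(a, r)]) (reward_pmf \<rho> (Obs a))))"

definition regret :: "(nat \<Rightarrow> complex mat) \<Rightarrow> nat \<Rightarrow> complex mat \<Rightarrow> (nat \<times> real) list \<Rightarrow> real" where
  "regret Obs k \<rho> h = (\<Sum>(a, r) \<leftarrow> h.
      Max ((\<lambda>i. Re (trace_mat (\<rho> * Obs i))) ` {..<k}) - Re (trace_mat (\<rho> * Obs a)))"

definition expected_regret :: "(nat \<Rightarrow> complex mat) \<Rightarrow> nat \<Rightarrow> complex mat
    \<Rightarrow> (nat \<Rightarrow> (nat \<times> real) list \<Rightarrow> nat pmf) \<Rightarrow> nat \<Rightarrow> real" where
  "expected_regret Obs k \<rho> \<pi> T = measure_pmf.expectation (hist_pmf Obs \<rho> \<pi> T) (regret Obs k \<rho>)"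

end

theory Submission
  imports Defs
begin

text \<open>
  Distinct Pauli strings \<open>S\<^sub>j\<close> are traceless involutions, orthogonal for the trace inner product, so
  in the state \<open>(I + \<Delta> S\<^sub>j) / d\<close> every arm yields a \<open>\<plusminus>1\<close> reward of mean \<open>0\<close>, except arm \<open>j\<close>, whose mean
  is \<open>\<Delta>\<close>. These \<open>k\<close> environments are compared with the maximally mixed state, under which all arms
  look alike: the change of measure is an explicit likelihood ratio \<open>L\<close>, and the baseline expectation
  of \<open>-ln L\<close> is \<open>-ln (1 - \<Delta>\<^sup>2) / 2\<close> times the expected number of pulls of \<open>j\<close>. As the baseline pull
  counts add up to \<open>T\<close>, averaging over \<open>j\<close> with \<open>\<Delta>\<^sup>2 = (k - 1) / (4 T)\<close> produces an environment whose
  best arm is missed in at least \<open>T / 6\<close> rounds on average.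
\<close>

unbundle no vec_syntax

section \<open>Traces, adjoints and Kronecker products\<close>

lemma adjoint_carrier [simp]: "A \<in> carrier_mat n m \<Longrightarrow> adjoint_mat A \<in> carrier_mat m n"
  by (auto simp: adjoint_mat_def)

lemma adjoint_mult:
  assumes "A \<in> carrier_mat n m" "B \<in> carrier_mat m l"
  shows "adjoint_mat (A * B) = adjoint_mat B * adjoint_mat A"
  using assms
  by (intro eq_matI) (auto simp: adjoint_mat_def scalar_prod_def mult.commute)

lemma adjoint_add:
  assumes "A \<in> carrier_mat n m" "B \<in> carrier_mat n m"
  shows "adjoint_mat (A + B) = adjoint_mat A + adjoint_mat B"
  using assms by (intro eq_matI) (auto simp: adjoint_mat_def)

lemma adjoint_smult: "adjoint_mat (c \<cdot>\<^sub>m A) = cnj c \<cdot>\<^sub>m adjoint_mat A"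
  by (intro eq_matI) (auto simp: adjoint_mat_def)

lemma adjoint_one [simp]: "adjoint_mat (1\<^sub>m n) = 1\<^sub>m n"
  by (intro eq_matI) (auto simp: adjoint_mat_def)

lemma hermitian_lincomb:
  assumes "A \<in> carrier_mat n n" "hermitian_mat A"
  shows "hermitian_mat (complex_of_real a \<cdot>\<^sub>m 1\<^sub>m n + complex_of_real b \<cdot>\<^sub>m A)"
  using assms unfolding hermitian_mat_def
  by (subst adjoint_add[of _ n n]) (auto simp: adjoint_smult)

lemma trace_add:
  assumes "A \<in> carrier_mat n n" "B \<in> carrier_mat n n"
  shows "trace_mat (A + B) = trace_mat A + trace_mat B"
  using assms by (auto simp: trace_mat_def sum.distrib)

lemma trace_smult:
  assumes "A \<in> carrier_mat n n"
  shows "trace_mat (c \<cdot>\<^sub>m A) = c * trace_mat A"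
  using assms by (auto simp: trace_mat_def sum_distrib_left)

lemma trace_one: "trace_mat (1\<^sub>m n) = of_nat n"
  by (simp add: trace_mat_def)

lemma cscalar_prod_adjoint:
  assumes A: "A \<in> carrier_mat n n" and u: "u \<in> carrier_vec n" and v: "v \<in> carrier_vec n"
  shows "(A *\<^sub>v u) \<bullet>c v = u \<bullet>c (adjoint_mat A *\<^sub>v v)"
proof -
  have "(A *\<^sub>v u) \<bullet>c v = (\<Sum>i<n. \<Sum>j<n. A $$ (i, j) * u $ j * cnj (v $ i))"
    using assms by (simp add: scalar_prod_def sum_distrib_right atLeast0LessThan)
  also have "\<dots> = (\<Sum>j<n. \<Sum>i<n. A $$ (i, j) * u $ j * cnj (v $ i))"
    by (rule sum.swap)
  also have "\<dots> = u \<bullet>c (adjoint_mat A *\<^sub>v v)"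
    using assms by (simp add: scalar_prod_def sum_distrib_left atLeast0LessThan adjoint_mat_def mult_ac)
  finally show ?thesis .
qed

lemma Re_cscalar_prod_self_nonneg: "0 \<le> Re (v \<bullet>c v)"
  using conjugate_square_ge_0_vec[of v] by (simp add: less_eq_complex_def)

section \<open>Kronecker products through quotient and remainder of indices\<close>

lemma sum_div_mod:
  fixes f :: "nat \<Rightarrow> nat \<Rightarrow> 'a::comm_monoid_add"
  shows "(\<Sum>i<a * b. f (i div b) (i mod b)) = (\<Sum>p<a. \<Sum>q<b. f p q)"
proof -
  have "(\<Sum>i<a * b. f (i div b) (i mod b)) = (\<Sum>p<a. \<Sum>i = p * b..<p * b + b. f (i div b) (i mod b))"
    by (rule sum.nat_group[symmetric])
  also have "\<dots> = (\<Sum>p<a. \<Sum>q<b. f p q)"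
  proof (rule sum.cong[OF refl])
    fix p
    have "(\<Sum>i = p * b..<p * b + b. f (i div b) (i mod b))
        = (\<Sum>q = 0..<b. f ((q + p * b) div b) ((q + p * b) mod b))"
      using sum.shift_bounds_nat_ivl[of "\<lambda>i. f (i div b) (i mod b)" 0 "p * b" b] by (simp add: add.commute)
    then show "(\<Sum>i = p * b..<p * b + b. f (i div b) (i mod b)) = (\<Sum>q<b. f p q)"
      by (simp add: atLeast0LessThan)
  qed
  finally show ?thesis .
qed

lemma div_mod_less:
  fixes i :: nat
  assumes "i < a * b"
  shows "i div b < a" "i mod b < b"
  using assms by (auto simp: less_mult_imp_div_less intro!: mod_less_divisor gr0I)

lemma kron_carrier:
  "A \<in> carrier_mat n m \<Longrightarrow> B \<in> carrier_mat n' m' \<Longrightarrow> kron_mat A B \<in> carrier_mat (n * n') (m * m')"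
  by (auto simp: kron_mat_def)

text \<open>The mixed-product rule. Splitting the summation index \<open>x\<close> into
  \<open>x div m\<close> and \<open>x mod m\<close> turns the entry on the left into a double sum
  whose terms factor, hence into a product of two entries.\<close>

lemma kron_mult:
  assumes "A \<in> carrier_mat n n" "C \<in> carrier_mat n n" "B \<in> carrier_mat m m" "D \<in> carrier_mat m m"
  shows "kron_mat A B * kron_mat C D = kron_mat (A * C) (B * D)"
proof (rule eq_matI)
  fix i j assume "i < dim_row (kron_mat (A * C) (B * D))" "j < dim_col (kron_mat (A * C) (B * D))"
  then have ij: "i < n * m" "j < n * m" using assms by (auto simp: kron_mat_def)
  note l = div_mod_less[OF ij(1)] div_mod_less[OF ij(2)]
  have "(kron_mat A B * kron_mat C D) $$ (i, j)
      = (\<Sum>x<n * m. (A $$ (i div m, x div m) * C $$ (x div m, j div m))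
                  * (B $$ (i mod m, x mod m) * D $$ (x mod m, j mod m)))"
    using assms ij by (simp add: kron_mat_def scalar_prod_def atLeast0LessThan mult_ac)
  also have "\<dots> = (\<Sum>p<n. \<Sum>q<m. (A $$ (i div m, p) * C $$ (p, j div m)) * (B $$ (i mod m, q) * D $$ (q, j mod m)))"
    by (rule sum_div_mod)
  also have "\<dots> = kron_mat (A * C) (B * D) $$ (i, j)"
    using assms ij l by (simp add: kron_mat_def scalar_prod_def sum_product atLeast0LessThan)
  finally show "(kron_mat A B * kron_mat C D) $$ (i, j) = kron_mat (A * C) (B * D) $$ (i, j)" .
qed (use assms in \<open>auto simp: kron_mat_def\<close>)

lemma adjoint_kron:
  assumes "A \<in> carrier_mat n n" "B \<in> carrier_mat m m"
  shows "adjoint_mat (kron_mat A B) = kron_mat (adjoint_mat A) (adjoint_mat B)"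
  using assms by (intro eq_matI) (auto simp: adjoint_mat_def kron_mat_def div_mod_less)

lemma trace_kron:
  assumes "A \<in> carrier_mat n n" "B \<in> carrier_mat m m"
  shows "trace_mat (kron_mat A B) = trace_mat A * trace_mat B"
proof -
  have "trace_mat (kron_mat A B) = (\<Sum>i<n * m. A $$ (i div m, i div m) * B $$ (i mod m, i mod m))"
    using assms by (simp add: trace_mat_def kron_mat_def)
  also have "\<dots> = (\<Sum>p<n. \<Sum>q<m. A $$ (p, p) * B $$ (q, q))"
    by (rule sum_div_mod)
  finally show ?thesis
    using assms by (simp add: trace_mat_def sum_product)
qed

lemma kron_one: "kron_mat (1\<^sub>m n) (1\<^sub>m m) = 1\<^sub>m (n * m)"
proof (rule eq_matI)
  fix i j assume "i < dim_row (1\<^sub>m (n * m) :: complex mat)" "j < dim_col (1\<^sub>m (n * m) :: complex mat)"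
  then have ij: "i < n * m" "j < n * m" by auto
  have "i = j \<longleftrightarrow> i div m = j div m \<and> i mod m = j mod m"
    by (metis div_mult_mod_eq)
  then show "kron_mat (1\<^sub>m n) (1\<^sub>m m) $$ (i, j) = (1\<^sub>m (n * m) :: complex mat) $$ (i, j)"
    using ij div_mod_less[OF ij(1)] div_mod_less[OF ij(2)] by (auto simp: kron_mat_def)
qed (auto simp: kron_mat_def)

section \<open>Pauli strings\<close>

lemma pauli_carrier [simp]: "pauli_mat P \<in> carrier_mat 2 2"
  by (cases P) (auto simp: pauli_mat_def mat_of_rows_list_def)

lemma pauli_hermitian: "adjoint_mat (pauli_mat P) = pauli_mat P"
  by (rule eq_matI; cases P)
    (auto simp: adjoint_mat_def pauli_mat_def mat_of_rows_list_def numeral_2_eq_2 less_Suc_eq)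

lemma pauli_square: "pauli_mat P * pauli_mat P = 1\<^sub>m 2"
  by (rule eq_matI; cases P)
    (auto simp: pauli_mat_def mat_of_rows_list_def numeral_2_eq_2 less_Suc_eq scalar_prod_def)

lemma trace_pauli: "trace_mat (pauli_mat P) = 0"
  by (cases P) (auto simp: trace_mat_def pauli_mat_def mat_of_rows_list_def numeral_2_eq_2)

text \<open>Two distinct Pauli matrices multiply to a phase times the third, which is traceless;
  equal ones multiply to the identity. The nine cases are checked entrywise.\<close>

lemma trace_pauli_mult: "trace_mat (pauli_mat P * pauli_mat Q) = (if P = Q then 2 else 0)"
  by (cases P; cases Q)
    (auto simp: trace_mat_def pauli_mat_def mat_of_rows_list_def scalar_prod_def numeral_2_eq_2)

lemma pauli_string_Nil: "pauli_string [] = 1\<^sub>m 1"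
  by (simp add: pauli_string_def)

lemma pauli_string_Cons: "pauli_string (P # ps) = kron_mat (pauli_mat P) (pauli_string ps)"
  by (simp add: pauli_string_def)

lemma pauli_string_carrier: "pauli_string ps \<in> carrier_mat (2 ^ length ps) (2 ^ length ps)"
proof (induction ps)
  case (Cons P ps)
  show ?case
    using kron_carrier[OF pauli_carrier Cons.IH, of P] by (simp add: pauli_string_Cons)
qed (simp add: pauli_string_Nil)

lemma pauli_string_hermitian: "hermitian_mat (pauli_string ps)"
proof (induction ps)
  case (Cons P ps)
  then show ?case
    using adjoint_kron[OF pauli_carrier pauli_string_carrier, of P ps]
    by (simp add: hermitian_mat_def pauli_string_Cons pauli_hermitian)
qed (simp add: pauli_string_Nil hermitian_mat_def)

lemma pauli_string_square: "pauli_string ps * pauli_string ps = 1\<^sub>m (2 ^ length ps)"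
proof (induction ps)
  case (Cons P ps)
  then show ?case
    using kron_mult[OF pauli_carrier[of P] pauli_carrier[of P] pauli_string_carrier[of ps] pauli_string_carrier]
    by (simp add: pauli_string_Cons pauli_square kron_one)
qed (simp add: pauli_string_Nil)

text \<open>The leading tensor factor already has trace zero. The empty string stands for the 1 by 1
  identity, whose trace is one.\<close>

lemma trace_pauli_string:
  assumes "ps \<noteq> []"
  shows "trace_mat (pauli_string ps) = 0"
  using assms trace_kron[OF pauli_carrier pauli_string_carrier]
  by (cases ps) (auto simp: pauli_string_Cons trace_pauli)

text \<open>The trace is multiplicative over tensor factors, so a single differing position makes it
  vanish. This orthogonality lets a state favour one arm while all others stay unbiased.\<close>

lemma trace_pauli_string_mult:
  assumes "length ps = length qs"
  shows "trace_mat (pauli_string ps * pauli_string qs) = (if ps = qs then 2 ^ length ps else 0)"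
  using assms
proof (induction ps qs rule: list_induct2)
  case (Cons P ps Q qs)
  have qs: "pauli_string qs \<in> carrier_mat (2 ^ length ps) (2 ^ length ps)"
    using pauli_string_carrier[of qs] Cons.hyps by simp
  have "trace_mat (pauli_string (P # ps) * pauli_string (Q # qs))
      = trace_mat (pauli_mat P * pauli_mat Q) * trace_mat (pauli_string ps * pauli_string qs)"
    unfolding pauli_string_Cons kron_mult[OF pauli_carrier pauli_carrier pauli_string_carrier qs]
    by (rule trace_kron[OF mult_carrier_mat[OF pauli_carrier pauli_carrier]
          mult_carrier_mat[OF pauli_string_carrier qs]])
  then show ?case
    using Cons.IH by (simp add: trace_pauli_mult)
qed (simp add: pauli_string_Nil trace_mat_def)

section \<open>Measuring traceless involutions\<close>

text \<open>\<open>eig_proj\<close> is a definite description, so a candidate has to be shown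
  unique. Each projector fixes the range of the other, giving \<open>P * Q = Q\<close> and
  \<open>Q * P = P\<close>; the adjoint of the first equation is \<open>Q * P = Q\<close>.\<close>

lemma hermitian_idempotent_unique:
  assumes P: "P \<in> carrier_mat n n" "P * P = P" "hermitian_mat P"
    and Q: "Q \<in> carrier_mat n n" "Q * Q = Q" "hermitian_mat Q"
    and fixed: "\<And>v. v \<in> carrier_vec n \<Longrightarrow> P *\<^sub>v v = v \<longleftrightarrow> Q *\<^sub>v v = v"
  shows "P = Q"
proof -
  \<comment> \<open>The columns of an idempotent \<open>B\<close> are fixed by \<open>B\<close>, so
    an \<open>A\<close> that fixes every vector fixed by \<open>B\<close> fixes these columns
    too.\<close>
  have absorb: "A * B = B"
    if A: "A \<in> carrier_mat n n" and B: "B \<in> carrier_mat n n" "B * B = B"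
      and f: "\<And>v. v \<in> carrier_vec n \<Longrightarrow> B *\<^sub>v v = v \<Longrightarrow> A *\<^sub>v v = v" for A B :: "complex mat"
  proof (rule mat_col_eqI)
    fix i assume "i < dim_col B"
    then have i: "i < n" using B by simp
    have "B *\<^sub>v col B i = col (B * B) i" using col_mult2[OF B(1) B(1) i] by simp
    also have "\<dots> = col B i" using B(2) by simp
    finally have "A *\<^sub>v col B i = col B i" using f[of "col B i"] B by (simp add: carrier_vecI del: col_mult2)
    then show "col (A * B) i = col B i" using A B i by simp
  qed (use A B in auto)
  have "P * Q = Q" using absorb[OF P(1) Q(1,2)] fixed by blast
  then have "adjoint_mat (P * Q) = adjoint_mat Q" by simp
  then have "Q * P = Q" using adjoint_mult[OF P(1) Q(1)] P(3) Q(3) by (simp add: hermitian_mat_def)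
  moreover have "Q * P = P" using absorb[OF Q(1) P(1,2)] fixed by blast
  ultimately show ?thesis by simp
qed

lemma is_eigenvalue_involution:
  assumes S: "S \<in> carrier_mat n n" "S * S = 1\<^sub>m n" and r: "is_eigenvalue S r"
  shows "r = 1 \<or> r = -1"
proof -
  obtain v where v: "v \<in> carrier_vec n" "v \<noteq> 0\<^sub>v n" "S *\<^sub>v v = complex_of_real r \<cdot>\<^sub>v v"
    using r S by (auto simp: is_eigenvalue_def)
  have "v = (S * S) *\<^sub>v v" using S v by simp
  also have "\<dots> = S *\<^sub>v (S *\<^sub>v v)" by (rule assoc_mult_mat_vec[OF S(1) S(1) v(1)])
  also have "\<dots> = complex_of_real (r * r) \<cdot>\<^sub>v v"
    using S v by (simp add: mult_mat_vec[OF S(1)] smult_smult_assoc)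
  finally have eq: "v = complex_of_real (r * r) \<cdot>\<^sub>v v" .
  obtain i where i: "i < n" "v $ i \<noteq> 0"
    using v(1,2) by (metis carrier_vecD eq_vecI index_zero_vec)
  have "v $ i = complex_of_real (r * r) * v $ i"
    using arg_cong[OF eq, of "\<lambda>w. w $ i"] i v(1) by simp
  then have "complex_of_real (r * r) = 1" using i by simp
  then have "r * r = 1" by (metis of_real_eq_1_iff)
  then show ?thesis by (simp add: square_eq_1_iff)
qed

text \<open>\<open>reward_pmf\<close> gives mass to eigenvalues only, so both signs must be shown to
  occur. Since \<open>r * r = 1\<close>, every nonzero column of \<open>B\<close>, which is r I + S,
  is an eigenvector for \<open>r\<close>; the trace of \<open>B\<close> is r n, so not all columns
  vanish.\<close>

lemma is_eigenvalue_traceless_involution: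
  assumes S: "S \<in> carrier_mat n n" "S * S = 1\<^sub>m n" "trace_mat S = 0" and n: "0 < n"
    and r: "r = 1 \<or> r = -1"
  shows "is_eigenvalue S r"
proof -
  define B where "B = complex_of_real r \<cdot>\<^sub>m 1\<^sub>m n + S"
  have B: "B \<in> carrier_mat n n" using S by (simp add: B_def)
  have "trace_mat B = complex_of_real r * of_nat n"
    unfolding B_def using S
    by (subst trace_add[of _ n]) (auto simp: trace_smult[of _ n] trace_one)
  then have tr: "trace_mat B \<noteq> 0" using n r by auto
  have "\<exists>j<n. col B j \<noteq> 0\<^sub>v n"
  proof (rule ccontr)
    assume "\<not> ?thesis"
    then have "B $$ (j, j) = 0" if "j < n" for j
      using that B by (metis carrier_matD index_col index_zero_vec(1))
    then show False using tr B by (auto simp: trace_mat_def)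
  qed
  then obtain j where j: "j < n" "col B j \<noteq> 0\<^sub>v n" by blast
  have "S * B = complex_of_real r \<cdot>\<^sub>m B"
  proof -
    have "S * B = complex_of_real r \<cdot>\<^sub>m S + 1\<^sub>m n"
      unfolding B_def using S by (simp add: mult_add_distrib_mat[of _ n n _ n] mult_smult_distrib[of _ n n _ n])
    also have "\<dots> = complex_of_real r \<cdot>\<^sub>m B"
      unfolding B_def using S r by (intro eq_matI) (auto simp: algebra_simps)
    finally show ?thesis .
  qed
  then have "S *\<^sub>v col B j = complex_of_real r \<cdot>\<^sub>v col B j"
    using S B j by (metis carrier_matD(2) col_mult2 col_smult)
  moreover have "dim_row S = n" "col B j \<in> carrier_vec n"
    using S B by (auto simp: carrier_vecI)
  ultimately show ?thesis
    unfolding is_eigenvalue_def using j(2) by metis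
qed

text \<open>The candidate is the spectral projector (I + r S) / 2. The squares of \<open>S\<close>
  and \<open>r\<close> being one makes it idempotent, and \<open>r\<close> being its own inverse
  turns its fixed-point equation into the eigenvalue equation.\<close>

lemma eig_proj_involution:
  assumes S: "S \<in> carrier_mat n n" "S * S = 1\<^sub>m n" "hermitian_mat S" and r: "r = 1 \<or> r = -1"
  shows "eig_proj S r = complex_of_real (1/2) \<cdot>\<^sub>m 1\<^sub>m n + complex_of_real (r/2) \<cdot>\<^sub>m S" (is "_ = ?P")
proof -
  have P: "?P \<in> carrier_mat n n" using S by simp
  have PP: "?P * ?P = ?P"
  proof -
    have "?P * ?P = complex_of_real (1/2) \<cdot>\<^sub>m ?P + complex_of_real (r/2) \<cdot>\<^sub>m (?P * S)"
      using S P by (subst (1) mult_add_distrib_mat[of _ n n _ n]) (auto simp: mult_smult_distrib[of _ n n])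
    also have "?P * S = complex_of_real (1/2) \<cdot>\<^sub>m S + complex_of_real (r/2) \<cdot>\<^sub>m 1\<^sub>m n"
      using S by (subst add_mult_distrib_mat[of _ n n]) (auto simp: mult_smult_assoc_mat[of _ n n])
    also have "complex_of_real (1/2) \<cdot>\<^sub>m ?P + complex_of_real (r/2) \<cdot>\<^sub>m \<dots> = ?P"
      using S r by (intro eq_matI) (auto simp: field_simps)
    finally show ?thesis .
  qed
  have Ph: "hermitian_mat ?P" by (rule hermitian_lincomb[OF S(1,3)])
  have fixed: "?P *\<^sub>v v = v \<longleftrightarrow> S *\<^sub>v v = complex_of_real r \<cdot>\<^sub>v v" if v: "v \<in> carrier_vec n" for v
  proof -
    have Sv: "S *\<^sub>v v \<in> carrier_vec n" using S v by simp
    have "?P *\<^sub>v v = complex_of_real (1/2) \<cdot>\<^sub>v v + complex_of_real (r/2) \<cdot>\<^sub>v (S *\<^sub>v v)"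
      using S v by (subst add_mult_distrib_mat_vec[of _ n n]) auto
    also have "\<dots> = v \<longleftrightarrow> (\<forall>i<n. v $ i / 2 + complex_of_real r * (S *\<^sub>v v) $ i / 2 = v $ i)"
      using v Sv S by (auto simp: vec_eq_iff)
    also have "\<dots> \<longleftrightarrow> (\<forall>i<n. (S *\<^sub>v v) $ i = complex_of_real r * v $ i)"
    proof -
      have "x / 2 + complex_of_real r * y / 2 = x \<longleftrightarrow> y = complex_of_real r * x" for x y :: complex
        using r by (auto simp: field_simps) 
      then show ?thesis by simp
    qed
    also have "\<dots> \<longleftrightarrow> S *\<^sub>v v = complex_of_real r \<cdot>\<^sub>v v"
      using v Sv S by (auto simp: vec_eq_iff)
    finally show ?thesis .
  qed
  have d: "dim_row S = n" using S by simp
  show ?thesis unfolding eig_proj_def d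
  proof (rule the_equality)
    show "?P \<in> carrier_mat n n \<and> ?P * ?P = ?P \<and> hermitian_mat ?P \<and>
      (\<forall>v\<in>carrier_vec n. (?P *\<^sub>v v = v) = (S *\<^sub>v v = complex_of_real r \<cdot>\<^sub>v v))"
      using P PP Ph fixed by blast
  next
    fix Q assume Q: "Q \<in> carrier_mat n n \<and> Q * Q = Q \<and> hermitian_mat Q \<and>
      (\<forall>v\<in>carrier_vec n. (Q *\<^sub>v v = v) = (S *\<^sub>v v = complex_of_real r \<cdot>\<^sub>v v))"
    show "Q = ?P"
    proof (rule hermitian_idempotent_unique[of Q n ?P])
      show "Q *\<^sub>v v = v \<longleftrightarrow> ?P *\<^sub>v v = v" if "v \<in> carrier_vec n" for v
        unfolding fixed[OF that] using Q that by blast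
    qed (use Q in \<open>blast intro: P PP Ph\<close>)+
  qed
qed

section \<open>States tilted towards one observable\<close>

definition tilted_state :: "nat \<Rightarrow> real \<Rightarrow> complex mat \<Rightarrow> complex mat" where
  "tilted_state n x S = complex_of_real (1 / n) \<cdot>\<^sub>m 1\<^sub>m n + complex_of_real (x / n) \<cdot>\<^sub>m S"

lemma tilted_state_carrier: "S \<in> carrier_mat n n \<Longrightarrow> tilted_state n x S \<in> carrier_mat n n"
  by (simp add: tilted_state_def)

text \<open>When \<open>B = S\<close> is a traceless involution the value is \<open>x\<close>; when
  \<open>B\<close> is traceless and orthogonal to \<open>S\<close> it is zero. So the tilt moves the
  mean of a single arm.\<close>

lemma trace_tilted_state_mult:
  assumes S: "S \<in> carrier_mat n n" and B: "B \<in> carrier_mat n n"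
  shows "trace_mat (tilted_state n x S * B)
       = (trace_mat B + complex_of_real x * trace_mat (S * B)) / of_nat n"
proof -
  have "tilted_state n x S * B = complex_of_real (1 / n) \<cdot>\<^sub>m B + complex_of_real (x / n) \<cdot>\<^sub>m (S * B)"
    unfolding tilted_state_def using S B
    by (subst add_mult_distrib_mat[of _ n n]) (auto simp: mult_smult_assoc_mat[of _ n n])
  then show ?thesis
    using S B by (simp add: trace_add[of _ n] trace_smult[of _ n] add_divide_distrib)
qed

text \<open>The first trace condition is a product so that \<open>x = 0\<close>, the maximally mixed
  state, is covered even for the empty string, whose trace is one.\<close>

lemma density_tilted_state:
  assumes S: "S \<in> carrier_mat n n" "S * S = 1\<^sub>m n" "hermitian_mat S" and n: "0 < n"
    and tr: "x * Re (trace_mat S) = 0" "Im (trace_mat S) = 0" and x: "0 \<le> x" "x \<le> 1"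
  shows "density_matrix n (tilted_state n x S)"
proof -
  have c: "tilted_state n x S \<in> carrier_mat n n" using S by (simp add: tilted_state_carrier)
  have "trace_mat (tilted_state n x S) = trace_mat (tilted_state n x S * 1\<^sub>m n)"
    using c by simp
  also have "\<dots> = (of_nat n + complex_of_real x * trace_mat S) / of_nat n"
    using S by (subst trace_tilted_state_mult) (auto simp: trace_one)
  also have "complex_of_real x * trace_mat S = 0"
    using tr by (auto simp: complex_eq_iff)
  finally have t: "trace_mat (tilted_state n x S) = 1" using n by simp
  have "0 \<le> Re ((tilted_state n x S *\<^sub>v v) \<bullet>c v)" if v: "v \<in> carrier_vec n" for v
  proof -
    \<comment> \<open>\<open>w\<close> is twice the projection of \<open>v\<close> onto the +1
      eigenspace of \<open>S\<close>. Its squared norm absorbs the indefinite term in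
      \<open>S\<close> and leaves the nonnegative weights \<open>1 - x\<close> and
      \<open>x / 2\<close>.\<close>
    define w where "w = v + S *\<^sub>v v"
    have Sv: "S *\<^sub>v v \<in> carrier_vec n" using S v by simp
    have SS: "(S *\<^sub>v v) \<bullet>c (S *\<^sub>v v) = v \<bullet>c v"
    proof -
      have "(S *\<^sub>v v) \<bullet>c (S *\<^sub>v v) = v \<bullet>c (S *\<^sub>v (S *\<^sub>v v))"
        using cscalar_prod_adjoint[OF S(1) v Sv] S(3) by (simp add: hermitian_mat_def)
      also have "S *\<^sub>v (S *\<^sub>v v) = v"
        using assoc_mult_mat_vec[OF S(1) S(1) v] S(2) v by simp
      finally show ?thesis .
    qed
    have vS: "v \<bullet>c (S *\<^sub>v v) = (S *\<^sub>v v) \<bullet>c v"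
      using cscalar_prod_adjoint[OF S(1) v v] S(3) by (simp add: hermitian_mat_def)
    have "w \<bullet>c w = 2 * (v \<bullet>c v) + 2 * ((S *\<^sub>v v) \<bullet>c v)"
      unfolding w_def conjugate_add_vec[OF v Sv]
      using v Sv by (simp add: add_scalar_prod_distrib[of _ n] scalar_prod_add_distrib[of _ n] SS vS)
    then have w: "Re ((S *\<^sub>v v) \<bullet>c v) = Re (w \<bullet>c w) / 2 - Re (v \<bullet>c v)" by (simp add: field_simps)
    have "tilted_state n x S *\<^sub>v v = complex_of_real (1/n) \<cdot>\<^sub>v v + complex_of_real (x/n) \<cdot>\<^sub>v (S *\<^sub>v v)"
      unfolding tilted_state_def using S v by (subst add_mult_distrib_mat_vec[of _ n n]) auto
    then have "(tilted_state n x S *\<^sub>v v) \<bullet>c v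
        = complex_of_real (1/n) * (v \<bullet>c v) + complex_of_real (x/n) * ((S *\<^sub>v v) \<bullet>c v)"
      using v Sv by (simp add: add_scalar_prod_distrib[of _ n])
    then have "Re ((tilted_state n x S *\<^sub>v v) \<bullet>c v)
        = (1/n) * Re (v \<bullet>c v) + (x/n) * Re ((S *\<^sub>v v) \<bullet>c v)"
      by simp
    also have "\<dots> = ((1 - x) * Re (v \<bullet>c v) + x / 2 * Re (w \<bullet>c w)) / n"
      unfolding w using n by (simp add: field_simps)
    also have "\<dots> \<ge> 0"
      using x Re_cscalar_prod_self_nonneg[of v] Re_cscalar_prod_self_nonneg[of w] by simp
    finally show ?thesis .
  qed
  moreover have "hermitian_mat (tilted_state n x S)"
    unfolding tilted_state_def by (rule hermitian_lincomb[OF S(1,3)])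
  ultimately show ?thesis using c t by (simp add: density_matrix_def)
qed

section \<open>Rewards as random signs with prescribed mean\<close>

definition sign_pmf :: "real \<Rightarrow> real pmf" where
  "sign_pmf x = map_pmf (\<lambda>b. if b then 1 else -1) (bernoulli_pmf ((1 + x) / 2))"

lemma pmf_sign_pmf:
  assumes "\<bar>x\<bar> \<le> 1"
  shows "pmf (sign_pmf x) r = (if r = 1 \<or> r = -1 then (1 + r * x) / 2 else 0)"
proof -
  have *: "(\<lambda>b. if b then 1 else - 1 :: real) -` {r}
      = (if r = 1 then {True} else if r = -1 then {False} else {})"
    by (auto split: if_splits)
  show ?thesis
    using assms unfolding sign_pmf_def pmf_map * by (auto simp: measure_pmf_single field_simps)
qed

text \<open>The Born rule with the projector (I + r S) / 2 gives \<open>(1 + r * x) / 2\<close>. As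
  the eigenvalues are exactly 1 and -1, the weight function inside \<open>reward_pmf\<close> is the
  mass function of \<open>sign_pmf x\<close>, from which \<open>embed_pmf\<close> recovers the
  distribution.\<close>

lemma reward_pmf_eq_sign_pmf:
  assumes S: "S \<in> carrier_mat n n" "S * S = 1\<^sub>m n" "hermitian_mat S" "trace_mat S = 0" and n: "0 < n"
    and \<rho>: "\<rho> \<in> carrier_mat n n" "trace_mat \<rho> = 1" and x: "Re (trace_mat (\<rho> * S)) = x" "\<bar>x\<bar> \<le> 1"
  shows "reward_pmf \<rho> S = sign_pmf x"
proof -
  have "Re (trace_mat (\<rho> * eig_proj S r)) = (1 + r * x) / 2" if r: "r = 1 \<or> r = -1" for r
  proof -
    have "\<rho> * eig_proj S r = complex_of_real (1/2) \<cdot>\<^sub>m \<rho> + complex_of_real (r/2) \<cdot>\<^sub>m (\<rho> * S)"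
      unfolding eig_proj_involution[OF S(1-3) r] using S \<rho>
      by (subst mult_add_distrib_mat[of _ n n _ n]) (auto simp: mult_smult_distrib[of _ n n])
    then have "trace_mat (\<rho> * eig_proj S r)
        = complex_of_real (1/2) * trace_mat \<rho> + complex_of_real (r/2) * trace_mat (\<rho> * S)"
      using S \<rho> by (simp add: trace_add[of _ n] trace_smult[of _ n])
    then have "Re (trace_mat (\<rho> * eig_proj S r)) = 1/2 * Re (trace_mat \<rho>) + r/2 * Re (trace_mat (\<rho> * S))"
      by simp
    then show ?thesis using x \<rho> by (simp add: field_simps)
  qed
  then have "(\<lambda>r. if is_eigenvalue S r then Re (trace_mat (\<rho> * eig_proj S r)) else 0) = pmf (sign_pmf x)"
    using is_eigenvalue_involution[OF S(1,2)] is_eigenvalue_traceless_involution[OF S(1,2,4) n]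
    by (intro ext) (auto simp: pmf_sign_pmf[OF x(2)])
  then show ?thesis
    unfolding reward_pmf_def by (simp add: type_definition.Rep_inverse[OF td_pmf_embed_pmf])
qed

section \<open>The sign-valued bandit\<close>

text \<open>Finite supports settle integrability throughout: with \<open>k\<close> actions and two
  possible rewards, only finitely many histories occur.\<close>

lemma expectation_bind_pmf_finite:
  fixes F :: "'b \<Rightarrow> real"
  assumes "finite (set_pmf p)" "\<And>x. x \<in> set_pmf p \<Longrightarrow> finite (set_pmf (f x))"
  shows "measure_pmf.expectation (bind_pmf p f) F
       = measure_pmf.expectation p (\<lambda>x. measure_pmf.expectation (f x) F)"
  using assms pmf_expectation_bind[of "set_pmf p" f p F]
  by (simp add: integral_measure_pmf[of "set_pmf p"])

lemma expectation_pmf_cong: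
  assumes "\<And>x. x \<in> set_pmf p \<Longrightarrow> f x = g x"
  shows "measure_pmf.expectation p f = measure_pmf.expectation p g"
  using assms by (intro integral_cong_AE) (auto simp: AE_measure_pmf_iff)

lemma expectation_sign_pmf:
  fixes F :: "real \<Rightarrow> real"
  assumes "\<bar>x\<bar> \<le> 1"
  shows "measure_pmf.expectation (sign_pmf x) F = ((1 + x) * F 1 + (1 - x) * F (-1)) / 2"
  using assms by (simp add: sign_pmf_def field_simps)

lemma finite_set_sign_pmf: "finite (set_pmf (sign_pmf x))"
  by (simp add: sign_pmf_def)

lemma set_hist_pmf:
  assumes "\<forall>t h. set_pmf (\<pi> t h) \<subseteq> {..<k}" and "h \<in> set_pmf (hist_pmf Obs \<rho> \<pi> t)"
  shows "length h = t \<and> (\<forall>(a, r)\<in>set h. a < k)"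
  using assms(2)
proof (induction t arbitrary: h)
  case (Suc t)
  then show ?case using assms(1) by fastforce
qed simp

lemma finite_set_hist_pmf:
  assumes "\<forall>t h. set_pmf (\<pi> t h) \<subseteq> {..<k::nat}"
    and "\<And>a. a < k \<Longrightarrow> finite (set_pmf (reward_pmf \<rho> (Obs a)))"
  shows "finite (set_pmf (hist_pmf Obs \<rho> \<pi> t))"
proof (induction t)
  case (Suc t)
  have "finite (set_pmf (\<pi> t h))" for h
    using assms(1) by (meson finite_lessThan finite_subset)
  then show ?case
    using Suc assms by (auto simp: subset_iff)
qed simp

text \<open>Averages out the last reward. This one-round recursion drives both later inductions over
  rounds.\<close>

lemma expectation_hist_pmf_Suc:
  fixes F :: "(nat \<times> real) list \<Rightarrow> real"
  assumes \<pi>: "\<forall>t h. set_pmf (\<pi> t h) \<subseteq> {..<k::nat}"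
    and R: "\<And>a. a < k \<Longrightarrow> reward_pmf \<rho> (Obs a) = sign_pmf (\<mu> a)" "\<And>a. a < k \<Longrightarrow> \<bar>\<mu> a\<bar> \<le> 1"
  shows "measure_pmf.expectation (hist_pmf Obs \<rho> \<pi> (Suc t)) F
       = measure_pmf.expectation (hist_pmf Obs \<rho> \<pi> t) (\<lambda>h. measure_pmf.expectation (\<pi> t h)
           (\<lambda>a. ((1 + \<mu> a) * F (h @ [(a, 1)]) + (1 - \<mu> a) * F (h @ [(a, -1)])) / 2))"
proof -
  have fin: "finite (set_pmf (reward_pmf \<rho> (Obs a)))" if "a < k" for a
    using R(1)[OF that] by (simp add: finite_set_sign_pmf)
  have fin\<pi>: "finite (set_pmf (\<pi> t h))" for h
    using \<pi> by (meson finite_lessThan finite_subset)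
  have "measure_pmf.expectation (bind_pmf (\<pi> t h) (\<lambda>a. map_pmf (\<lambda>r. h @ [(a, r)]) (reward_pmf \<rho> (Obs a)))) F
      = measure_pmf.expectation (\<pi> t h)
           (\<lambda>a. ((1 + \<mu> a) * F (h @ [(a, 1)]) + (1 - \<mu> a) * F (h @ [(a, -1)])) / 2)" for h
  proof -
    have "measure_pmf.expectation (bind_pmf (\<pi> t h) (\<lambda>a. map_pmf (\<lambda>r. h @ [(a, r)]) (reward_pmf \<rho> (Obs a)))) F
        = measure_pmf.expectation (\<pi> t h)
            (\<lambda>a. measure_pmf.expectation (map_pmf (\<lambda>r. h @ [(a, r)]) (reward_pmf \<rho> (Obs a))) F)"
      using fin fin\<pi> \<pi> by (intro expectation_bind_pmf_finite) (auto simp: subset_iff)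
    also have "\<dots> = measure_pmf.expectation (\<pi> t h)
           (\<lambda>a. ((1 + \<mu> a) * F (h @ [(a, 1)]) + (1 - \<mu> a) * F (h @ [(a, -1)])) / 2)"
    proof (rule expectation_pmf_cong)
      fix a assume "a \<in> set_pmf (\<pi> t h)"
      then have "a < k" using \<pi> by auto
      then show "measure_pmf.expectation (map_pmf (\<lambda>r. h @ [(a, r)]) (reward_pmf \<rho> (Obs a))) F
          = ((1 + \<mu> a) * F (h @ [(a, 1)]) + (1 - \<mu> a) * F (h @ [(a, -1)])) / 2"
        using R by (simp add: expectation_sign_pmf)
    qed
    finally show ?thesis .
  qed
  moreover have "finite (set_pmf (bind_pmf (\<pi> t h) (\<lambda>a. map_pmf (\<lambda>r. h @ [(a, r)]) (reward_pmf \<rho> (Obs a)))))" for h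
    using fin fin\<pi> \<pi> by (auto simp: subset_iff)
  ultimately show ?thesis
    using finite_set_hist_pmf[where k = k, OF \<pi> fin]
    by (simp only: hist_pmf.simps(2) expectation_bind_pmf_finite)
qed

section \<open>Likelihood ratios against the unbiased baseline\<close>

definition pulls :: "nat \<Rightarrow> (nat \<times> real) list \<Rightarrow> real" where
  "pulls j h = (\<Sum>(a, r)\<leftarrow>h. if a = j then 1 else 0)"

text \<open>Log-likelihood ratio of the environment in which arm \<open>j\<close> has mean \<open>\<Delta>\<close> against the one in
  which all means vanish.\<close>
definition loglik :: "nat \<Rightarrow> real \<Rightarrow> (nat \<times> real) list \<Rightarrow> real" where
  "loglik j \<Delta> h = (\<Sum>(a, r)\<leftarrow>h. if a = j then ln (1 + r * \<Delta>) else 0)"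

text \<open>A reward \<open>r\<close> of arm \<open>j\<close> has likelihood ratio
  \<open>1 + r * \<Delta>\<close>, positive for |\<Delta>| < 1; other arms have ratio one, and the
  action probabilities cancel because both processes follow the same policy. \<open>F\<close> is
  arbitrary in the induction, which is applied to its one-round average.\<close>

lemma change_of_measure:
  fixes F :: "(nat \<times> real) list \<Rightarrow> real"
  assumes \<pi>: "\<forall>t h. set_pmf (\<pi> t h) \<subseteq> {..<k::nat}" and \<Delta>: "\<bar>\<Delta>\<bar> < 1"
    and R0: "\<And>a. a < k \<Longrightarrow> reward_pmf \<rho>\<^sub>0 (Obs a) = sign_pmf 0"
    and R: "\<And>a. a < k \<Longrightarrow> reward_pmf \<rho> (Obs a) = sign_pmf (if a = j then \<Delta> else 0)"
  shows "measure_pmf.expectation (hist_pmf Obs \<rho> \<pi> t) F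
       = measure_pmf.expectation (hist_pmf Obs \<rho>\<^sub>0 \<pi> t) (\<lambda>h. exp (loglik j \<Delta> h) * F h)"
proof (induction t arbitrary: F)
  case 0
  then show ?case by (simp add: loglik_def)
next
  case (Suc t)
  have pos: "1 + \<Delta> > 0" "1 - \<Delta> > 0" using \<Delta> by auto
  let ?\<mu> = "\<lambda>a. if a = j then \<Delta> else 0"
  let ?L = "\<lambda>h. exp (loglik j \<Delta> h)"
  \<comment> \<open>The ratio of the last reward moves from the weights into the likelihood of the
    longer history. The weights \<open>1 + 0\<close> and \<open>1 - 0\<close> match the one-round
    recursion with mean zero.\<close>
  have step: "?L h * (((1 + ?\<mu> a) * F (h @ [(a, 1)]) + (1 - ?\<mu> a) * F (h @ [(a, -1)])) / 2)
      = ((1 + 0) * (?L (h @ [(a, 1)]) * F (h @ [(a, 1)]))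
        + (1 - 0) * (?L (h @ [(a, -1)]) * F (h @ [(a, -1)]))) / 2" for h a
    using pos by (simp add: loglik_def exp_add distrib_left)
  have "measure_pmf.expectation (hist_pmf Obs \<rho> \<pi> (Suc t)) F
      = measure_pmf.expectation (hist_pmf Obs \<rho> \<pi> t) (\<lambda>h. measure_pmf.expectation (\<pi> t h)
          (\<lambda>a. ((1 + ?\<mu> a) * F (h @ [(a, 1)]) + (1 - ?\<mu> a) * F (h @ [(a, -1)])) / 2))"
    using \<Delta> by (intro expectation_hist_pmf_Suc[where k = k, OF \<pi> R]) auto
  also have "\<dots> = measure_pmf.expectation (hist_pmf Obs \<rho>\<^sub>0 \<pi> t) (\<lambda>h. measure_pmf.expectation (\<pi> t h)
          (\<lambda>a. ?L h * (((1 + ?\<mu> a) * F (h @ [(a, 1)]) + (1 - ?\<mu> a) * F (h @ [(a, -1)])) / 2)))"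
    by (simp only: Suc.IH integral_mult_right_zero)
  also have "\<dots> = measure_pmf.expectation (hist_pmf Obs \<rho>\<^sub>0 \<pi> (Suc t)) (\<lambda>h. ?L h * F h)"
    unfolding step
    by (intro expectation_hist_pmf_Suc[where k = k and \<mu> = "\<lambda>_. 0", OF \<pi> R0, symmetric]) auto
  finally show ?case .
qed

text \<open>Baseline signs are fair, so a pull of \<open>j\<close> changes the log-likelihood by
  \<open>(ln (1 + \<Delta>) + ln (1 - \<Delta>)) / 2\<close> on average. Subtracting this drift
  leaves a martingale that starts at zero.\<close>

lemma expectation_loglik:
  assumes \<pi>: "\<forall>t h. set_pmf (\<pi> t h) \<subseteq> {..<k::nat}"
    and R0: "\<And>a. a < k \<Longrightarrow> reward_pmf \<rho>\<^sub>0 (Obs a) = sign_pmf 0"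
  shows "measure_pmf.expectation (hist_pmf Obs \<rho>\<^sub>0 \<pi> t)
    (\<lambda>h. loglik j \<Delta> h - (ln (1 + \<Delta>) + ln (1 - \<Delta>)) / 2 * pulls j h) = 0"
proof (induction t)
  case 0
  then show ?case by (simp add: loglik_def pulls_def)
next
  case (Suc t)
  let ?c = "(ln (1 + \<Delta>) + ln (1 - \<Delta>)) / 2"
  let ?F = "\<lambda>h. loglik j \<Delta> h - ?c * pulls j h"
  have "((1 + 0) * ?F (h @ [(a, 1)]) + (1 - 0) * ?F (h @ [(a, -1)])) / 2 = ?F h" for h a
    by (simp add: loglik_def pulls_def field_simps)
  then have "measure_pmf.expectation (hist_pmf Obs \<rho>\<^sub>0 \<pi> (Suc t)) ?F
      = measure_pmf.expectation (hist_pmf Obs \<rho>\<^sub>0 \<pi> t) (\<lambda>h. measure_pmf.expectation (\<pi> t h) (\<lambda>_. ?F h))"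
    by (subst expectation_hist_pmf_Suc[where k = k and \<mu> = "\<lambda>_. 0", OF \<pi> R0])
      (simp_all only: abs_zero zero_le_one)
  then show ?case
    using Suc.IH by simp
qed

text \<open>With \<open>l\<close> the log-likelihood ratio, the term \<open>exp l - 1 - l\<close> has the Kullback-Leibler divergence as
  its baseline expectation. The result is a Pinsker inequality that is linear in the divergence, so
  that it can be summed over arms; \<open>1 / 8\<close> is the choice of AM-GM weight suited to the final constant.\<close>
lemma exp_tilt_bound:
  fixes l x T :: real
  assumes "\<bar>x\<bar> \<le> T / 2"
  shows "(exp l - 1) * x \<le> T * (exp l - 1 - l) + T * (exp l + 1) / 8"
proof -
  \<comment> \<open>The square root of the likelihood ratio, as in the Hellinger distance: it
    factors \<open>exp l - 1\<close> as (y - 1) (y + 1).\<close>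
  define y where "y = exp (l / 2)"
  have L: "exp l = y\<^sup>2" by (simp add: y_def power2_eq_square flip: exp_add)
  have y: "1 + l / 2 \<le> y" "0 < y" unfolding y_def by (auto intro: exp_ge_add_one_self)
  have T: "0 \<le> T" using assms by linarith
  have "(y\<^sup>2 - 1) * x \<le> \<bar>y\<^sup>2 - 1\<bar> * \<bar>x\<bar>"
    by (metis abs_ge_self abs_mult)
  also have "\<dots> \<le> \<bar>y\<^sup>2 - 1\<bar> * (T / 2)"
    using assms by (intro mult_left_mono) auto
  also have "\<dots> = T * (2 * \<bar>y - 1\<bar> * ((y + 1) / 4))"
  proof -
    have "y\<^sup>2 - 1 = (y - 1) * (y + 1)" by (simp add: power2_eq_square algebra_simps)
    then show ?thesis using y by (simp add: abs_mult)
  qed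
  \<comment> \<open>AM-GM for |y - 1| and (y + 1) / 4. The first square is then dominated by the
    divergence term through \<open>1 + l / 2 \<le> y\<close>.\<close>
  also have "\<dots> \<le> T * ((y - 1)\<^sup>2 + ((y + 1) / 4)\<^sup>2)"
    using T sum_squares_bound[of "\<bar>y - 1\<bar>" "(y + 1) / 4"] by (intro mult_left_mono) auto
  also have "\<dots> \<le> T * ((y\<^sup>2 - 1 - l) + (y\<^sup>2 + 1) / 8)"
  proof (intro mult_left_mono add_mono T)
    show "(y - 1)\<^sup>2 \<le> y\<^sup>2 - 1 - l" using y by (simp add: power2_diff)
    show "((y + 1) / 4)\<^sup>2 \<le> (y\<^sup>2 + 1) / 8"
      using zero_le_power2[of "y - 1"] by (simp add: power2_eq_square field_simps)
  qed
  finally show ?thesis by (simp add: L distrib_left)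
qed

section \<open>Pull counts across environments\<close>

lemma pulls_bounds: "0 \<le> pulls j h" "pulls j h \<le> real (length h)"
  by (induction h) (auto simp: pulls_def)

lemma sum_pulls:
  assumes "\<forall>(a, r)\<in>set h. a < k"
  shows "(\<Sum>j<k. pulls j h) = real (length h)"
  using assms
proof (induction h)
  case (Cons x h)
  obtain a r where "x = (a, r)" by force
  then show ?case using Cons by (simp add: pulls_def sum.distrib)
qed (simp add: pulls_def)

text \<open>The count is centred at T / 2, so its deviation is at most T / 2 and
  \<open>exp_tilt_bound\<close> applies to each history. Under the baseline
  \<open>exp (loglik j \<Delta> h)\<close> has mean one: the centring term vanishes, the divergence
  term becomes a multiple of the baseline count of \<open>j\<close>, and the last term becomes T /
  4.\<close>

lemma expected_pulls_le:
  assumes \<pi>: "\<forall>t h. set_pmf (\<pi> t h) \<subseteq> {..<k::nat}" and \<Delta>: "\<bar>\<Delta>\<bar> < 1"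
    and R0: "\<And>a. a < k \<Longrightarrow> reward_pmf \<rho>\<^sub>0 (Obs a) = sign_pmf 0"
    and R: "\<And>a. a < k \<Longrightarrow> reward_pmf \<rho> (Obs a) = sign_pmf (if a = j then \<Delta> else 0)"
  shows "measure_pmf.expectation (hist_pmf Obs \<rho> \<pi> T) (pulls j)
      \<le> (1 - T * ln (1 - \<Delta>\<^sup>2) / 2) * measure_pmf.expectation (hist_pmf Obs \<rho>\<^sub>0 \<pi> T) (pulls j) + T / 4"
proof -
  let ?H = "hist_pmf Obs \<rho>\<^sub>0 \<pi> T"
  let ?l = "loglik j \<Delta>"
  have fin: "finite (set_pmf ?H)"
    using R0 by (intro finite_set_hist_pmf[OF \<pi>]) (simp add: finite_set_sign_pmf)
  have int [simp]: "integrable (measure_pmf ?H) f" for f :: "_ \<Rightarrow> real"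
    using fin by (rule integrable_measure_pmf_finite)
  note com = change_of_measure[OF \<pi> \<Delta> R0 R]
  have one: "measure_pmf.expectation ?H (\<lambda>h. exp (?l h)) = 1"
    using com[where t = T and F = "\<lambda>_. 1"] by simp
  have "ln (1 + \<Delta>) + ln (1 - \<Delta>) = ln (1 - \<Delta>\<^sup>2)"
    using \<Delta> by (simp add: power2_eq_square algebra_simps flip: ln_mult_pos)
  then have l: "measure_pmf.expectation ?H ?l
      = ln (1 - \<Delta>\<^sup>2) / 2 * measure_pmf.expectation ?H (pulls j)"
    using expectation_loglik[where Obs = Obs and t = T and j = j and \<Delta> = \<Delta>, OF \<pi> R0] by simp
  have "measure_pmf.expectation (hist_pmf Obs \<rho> \<pi> T) (pulls j)
      = measure_pmf.expectation ?H (\<lambda>h. exp (?l h) * pulls j h)"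
    by (rule com)
  also have "\<dots> \<le> measure_pmf.expectation ?H (\<lambda>h. pulls j h + (exp (?l h) - 1) * (T / 2)
       + T * (exp (?l h) - 1 - ?l h) + T * (exp (?l h) + 1) / 8)"
  proof (intro integral_mono_AE int)
    have "exp (?l h) * pulls j h \<le> pulls j h + (exp (?l h) - 1) * (T / 2)
       + T * (exp (?l h) - 1 - ?l h) + T * (exp (?l h) + 1) / 8" if "h \<in> set_pmf ?H" for h
    proof -
      have "length h = T" using set_hist_pmf[OF \<pi> that] by simp
      then have "\<bar>pulls j h - T / 2\<bar> \<le> T / 2"
        using pulls_bounds[of j h] by (simp add: abs_le_iff field_simps)
      from exp_tilt_bound[OF this, of "?l h"] show ?thesis by (simp add: algebra_simps)
    qed
    then show "AE h in measure_pmf ?H. exp (?l h) * pulls j h \<le> pulls j h + (exp (?l h) - 1) * (T / 2)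
       + T * (exp (?l h) - 1 - ?l h) + T * (exp (?l h) + 1) / 8"
      by (simp add: AE_measure_pmf_iff)
  qed
  also have "\<dots> = measure_pmf.expectation ?H (pulls j) - T * measure_pmf.expectation ?H ?l + T / 4"
    by (simp add: one)
  also have "\<dots> = (1 - T * ln (1 - \<Delta>\<^sup>2) / 2) * measure_pmf.expectation ?H (pulls j) + T / 4"
    by (simp add: l algebra_simps)
  finally show ?thesis .
qed

text \<open>With u the square of \<Delta>, ln z \<le> z - 1 at z = 1 / (1 - u) gives the bound u /
  (1 - u), and u \<le> 1 / 4 keeps the denominator above 3 / 4.\<close>

lemma neg_ln_one_minus_square_le:
  fixes \<Delta> :: real
  assumes "\<Delta>\<^sup>2 \<le> 1 / 4"
  shows "- ln (1 - \<Delta>\<^sup>2) \<le> 4 / 3 * \<Delta>\<^sup>2"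
proof -
  have "- ln (1 - \<Delta>\<^sup>2) = ln (1 / (1 - \<Delta>\<^sup>2))" using assms by (simp add: ln_div)
  also have "\<dots> \<le> 1 / (1 - \<Delta>\<^sup>2) - 1" using assms by (intro ln_le_minus_one) auto
  also have "\<dots> \<le> 4 / 3 * \<Delta>\<^sup>2"
  proof -
    have "\<Delta>\<^sup>2 * \<Delta>\<^sup>2 \<le> \<Delta>\<^sup>2 * (1 / 4)" using assms by (intro mult_left_mono) auto
    then show ?thesis using assms by (simp add: field_simps)
  qed
  finally show ?thesis .
qed

text \<open>Suppose each arm were pulled more than 5 T / 6 times on average in its own environment.
  Summing \<open>expected_pulls_le\<close> over the arms bounds the total by (c + k / 4) T, because
  the baseline counts share the budget T; this is too small once k \<ge> 2.\<close>

lemma ex_rarely_pulled_arm: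
  fixes T :: nat and \<Delta> :: real
  assumes \<pi>: "\<forall>t h. set_pmf (\<pi> t h) \<subseteq> {..<k::nat}" and k: "2 \<le> k"
    and \<Delta>: "\<Delta>\<^sup>2 \<le> 1 / 4" "\<Delta>\<^sup>2 * T \<le> (real k - 1) / 4"
    and R0: "\<And>a. a < k \<Longrightarrow> reward_pmf \<rho>\<^sub>0 (Obs a) = sign_pmf 0"
    and R: "\<And>j a. j < k \<Longrightarrow> a < k \<Longrightarrow> reward_pmf (\<rho> j) (Obs a) = sign_pmf (if a = j then \<Delta> else 0)"
  shows "\<exists>j<k. T / 6 \<le> T - measure_pmf.expectation (hist_pmf Obs (\<rho> j) \<pi> T) (pulls j)"
proof (rule ccontr)
  assume neg: "\<not> ?thesis"
  let ?H = "hist_pmf Obs \<rho>\<^sub>0 \<pi> T"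
  define N where "N j = measure_pmf.expectation ?H (pulls j)" for j
  define M where "M j = measure_pmf.expectation (hist_pmf Obs (\<rho> j) \<pi> T) (pulls j)" for j
  define c where "c = 1 - T * ln (1 - \<Delta>\<^sup>2) / 2"
  have "\<Delta>\<^sup>2 < 1" using \<Delta>(1) by simp
  then have \<Delta>1: "\<bar>\<Delta>\<bar> < 1" by (simp add: abs_square_less_1)
  have fin: "finite (set_pmf ?H)"
    using R0 by (intro finite_set_hist_pmf[OF \<pi>]) (simp add: finite_set_sign_pmf)
  have "(\<Sum>j<k. N j) = measure_pmf.expectation ?H (\<lambda>h. \<Sum>j<k. pulls j h)"
    unfolding N_def
    by (intro Bochner_Integration.integral_sum[symmetric] integrable_measure_pmf_finite fin)
  also have "\<dots> = measure_pmf.expectation ?H (\<lambda>_. real T)"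
    using set_hist_pmf[OF \<pi>] by (intro expectation_pmf_cong) (simp add: sum_pulls)
  finally have N: "(\<Sum>j<k. N j) = T" by simp
  have M: "M j \<le> c * N j + T / 4" if "j < k" for j
    unfolding M_def N_def c_def using expected_pulls_le[OF \<pi> \<Delta>1 R0 R[OF that]] by simp
  have lt: "5 / 6 * T < M j" if "j < k" for j
    using neg that unfolding M_def by (auto simp: field_simps not_le)
  have "k * (5 / 6 * T) = (\<Sum>j<k. 5 / 6 * T)" by simp
  also have "\<dots> < (\<Sum>j<k. M j)" using lt k by (intro sum_strict_mono) (auto simp: lessThan_empty_iff)
  also have "\<dots> \<le> (\<Sum>j<k. c * N j + T / 4)" using M by (intro sum_mono) auto
  also have "\<dots> = c * T + k * T / 4" by (simp add: sum.distrib N flip: sum_distrib_left)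
  also have "\<dots> \<le> (1 + (real k - 1) / 6) * T + k * T / 4"
  proof (intro add_right_mono mult_right_mono)
    have "T * - ln (1 - \<Delta>\<^sup>2) \<le> T * (4 / 3 * \<Delta>\<^sup>2)"
      using neg_ln_one_minus_square_le[OF \<Delta>(1)] by (intro mult_left_mono) auto
    then show "c \<le> 1 + (real k - 1) / 6"
      unfolding c_def using \<Delta>(2) by (simp add: field_simps)
  qed simp
  \<comment> \<open>The constants combine as 1 - 1/6 = 5/6 and 1/6 + 1/4 = 5/12. Without the factor
    T the two sides agree at k = 2, which is where the threshold 5/6 comes from.\<close>
  finally have "(5 / 6 * real k) * T < (5 / 6 + 5 / 12 * real k) * T" by (simp add: field_simps)
  then have "5 / 6 * real k < 5 / 6 + 5 / 12 * real k" by (rule mult_right_less_imp_less) simp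
  then show False using k by simp
qed

section \<open>The lower bound\<close>

theorem mainTheorem6:
  fixes T m k :: nat
    and ps :: "nat \<Rightarrow> pauli list"
    and \<pi> :: "nat \<Rightarrow> (nat \<times> real) list \<Rightarrow> nat pmf"
  assumes "\<forall>i<k. length (ps i) = m"
    and "inj_on ps {..<k}"
    and "\<forall>t h. set_pmf (\<pi> t h) \<subseteq> {..<k}"
    and "T \<ge> 2 * (k - 1)"
  shows "\<exists>\<rho>. density_matrix (2 ^ m) \<rho> \<and>
           expected_regret (\<lambda>i. pauli_string (ps i)) k \<rho> \<pi> T \<ge> 3 / 100 * sqrt ((real k - 1) * real T)"
proof -
  define S where "S i = pauli_string (ps i)" for i
  define d :: nat where "d = 2 ^ m"
  define \<rho> where "\<rho> j x = tilted_state d x (S j)" for j x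
  note \<pi> = assms(3)
  have d: "0 < d" by (simp add: d_def)
  have S: "S i \<in> carrier_mat d d" "S i * S i = 1\<^sub>m d" "hermitian_mat (S i)" if "i < k" for i
    using assms(1) that pauli_string_carrier[of "ps i"] pauli_string_square[of "ps i"]
    by (auto simp: S_def d_def pauli_string_hermitian)
  \<comment> \<open>A probability mass function has nonempty support, so a policy on these actions
    forces at least one arm.\<close>
  have "{..<k} \<noteq> {}"
    using \<pi> set_pmf_not_empty[of "\<pi> 0 []"] by (metis subset_empty)
  then have k0: "0 < k" by auto
  show ?thesis
  proof (cases "k = 1")
    \<comment> \<open>With one arm both the bound and the regret are zero, and the maximally mixed
      state serves. The only string may be empty here, hence not traceless.\<close>
    case True
    have "Im (trace_mat (S 0)) = 0"
    proof (cases "ps 0")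
      case Nil
      then show ?thesis by (simp add: S_def pauli_string_Nil trace_mat_def)
    next
      case Cons
      then show ?thesis by (simp add: S_def trace_pauli_string)
    qed
    then have "density_matrix d (\<rho> 0 0)"
      unfolding \<rho>_def using S[OF k0] d by (intro density_tilted_state) auto
    moreover have "regret S k (\<rho> 0 0) h = 0" if "h \<in> set_pmf (hist_pmf S (\<rho> 0 0) \<pi> T)" for h
    proof -
      have "\<forall>(a, r)\<in>set h. a = 0" using set_hist_pmf[OF \<pi> that] True by auto
      then have "map (\<lambda>(a, r). Max ((\<lambda>i. Re (trace_mat (\<rho> 0 0 * S i))) ` {..<k})
          - Re (trace_mat (\<rho> 0 0 * S a))) h = map (\<lambda>_. 0) h"
        using True by (intro map_cong) (auto simp: lessThan_Suc)
      from arg_cong[OF this, of sum_list] show ?thesis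
        by (simp only: regret_def sum_list_0)
    qed
    then have "expected_regret S k (\<rho> 0 0) \<pi> T = measure_pmf.expectation (hist_pmf S (\<rho> 0 0) \<pi> T) (\<lambda>_. 0)"
      unfolding expected_regret_def by (rule expectation_pmf_cong)
    ultimately show ?thesis
      using True unfolding S_def d_def by auto
  next
    case False
    then have k: "2 \<le> k" using k0 by simp
    \<comment> \<open>Two distinct strings of equal length cannot be empty, so all observables are
      traceless from here on.\<close>
    have ne: "ps i \<noteq> []" if "i < k" for i
    proof
      assume "ps i = []"
      then have "m = 0" using assms(1) that by auto
      then have "ps 0 = ps 1" using assms(1) k by simp
      then show False using inj_onD[OF assms(2), of 0 1] k by simp
    qed
    have tr0: "trace_mat (S i) = 0" if "i < k" for i
      unfolding S_def using ne[OF that] by (rule trace_pauli_string)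
    have trS: "trace_mat (S i * S j) = (if i = j then of_nat d else 0)" if "i < k" "j < k" for i j
      using trace_pauli_string_mult[of "ps i" "ps j"] assms(1) that inj_on_eq_iff[OF assms(2), of i j]
      by (simp add: S_def d_def)
    have mean: "Re (trace_mat (\<rho> j x * S a)) = (if a = j then x else 0)" if "j < k" "a < k" for j a x
      unfolding \<rho>_def using trace_tilted_state_mult[OF S(1)[OF that(1)] S(1)[OF that(2)], of x] d that
      by (simp add: tr0 trS)
    have dens: "density_matrix d (\<rho> j x)" if "j < k" "0 \<le> x" "x \<le> 1" for j x
      unfolding \<rho>_def using S[OF that(1)] d tr0[OF that(1)] that by (intro density_tilted_state) auto
    have rew: "reward_pmf (\<rho> j x) (S a) = sign_pmf (if a = j then x else 0)"
      if "j < k" "a < k" "0 \<le> x" "x \<le> 1" for j a x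
      using S[OF that(2)] tr0[OF that(2)] d dens[OF that(1,3,4)] mean[OF that(1,2)] that
      by (intro reward_pmf_eq_sign_pmf[of _ d]) (auto simp: density_matrix_def)
    define n where "n = real k - 1"
    have n: "1 \<le> n" "real k = n + 1" using k by (auto simp: n_def)
    have T: "2 * n \<le> T" using assms(4) k by (simp add: n_def flip: of_nat_diff)
    \<comment> \<open>The largest tilt allowed by
      \<open>x\<^sup>2 * T \<le> (real k - 1) / 4\<close>. The assumption T \<ge> 2 n makes its
      square at most 1 / 8.\<close>
    define x where "x = sqrt (n / T) / 2"
    have x2: "x\<^sup>2 = n / T / 4" using n by (simp add: x_def power_divide)
    have x2': "x\<^sup>2 \<le> 1 / 4" using n T unfolding x2 by (simp add: field_simps)
    have x0: "0 \<le> x" using n by (simp add: x_def)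
    have x1: "x \<le> 1" using x2' x0 by (simp add: power2_le_imp_le[of x 1])
    have xT: "x * T = sqrt (n * T) / 2"
      using n T by (simp add: x_def real_sqrt_divide real_sqrt_mult field_simps)
    obtain j where j: "j < k"
      and pj: "T / 6 \<le> T - measure_pmf.expectation (hist_pmf S (\<rho> j x) \<pi> T) (pulls j)"
    proof -
      \<comment> \<open>The baseline \<open>\<rho> 0 0\<close> is the maximally mixed state; with
        tilt zero, any index would give the same matrix.\<close>
      have "\<exists>j<k. T / 6 \<le> T - measure_pmf.expectation (hist_pmf S (\<rho> j x) \<pi> T) (pulls j)"
      proof (rule ex_rarely_pulled_arm[where \<rho>\<^sub>0 = "\<rho> 0 0" and \<rho> = "\<lambda>j. \<rho> j x" and Obs = S, OF \<pi> k x2'])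
        show "x\<^sup>2 * T \<le> (real k - 1) / 4" using n T by (simp add: x2)
        show "reward_pmf (\<rho> 0 0) (S a) = sign_pmf 0" if "a < k" for a
          using rew[OF k0 that, of 0] by simp
        show "reward_pmf (\<rho> j x) (S a) = sign_pmf (if a = j then x else 0)" if "j < k" "a < k" for j a
          by (rule rew[OF that x0 x1])
      qed
      then show ?thesis using that by blast
    qed
    let ?H = "hist_pmf S (\<rho> j x) \<pi> T"
    have fin: "finite (set_pmf ?H)"
      using rew[OF j _ x0 x1] by (intro finite_set_hist_pmf[OF \<pi>]) (simp add: finite_set_sign_pmf)
    have Max_eq: "Max ((\<lambda>i. Re (trace_mat (\<rho> j x * S i))) ` {..<k}) = x"
    proof (rule Max_eqI)
      show "x \<in> (\<lambda>i. Re (trace_mat (\<rho> j x * S i))) ` {..<k}"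
        using j mean[OF j j, of x] by (intro image_eqI[of _ _ j]) auto
    qed (use mean[OF j] x0 in auto)
    \<comment> \<open>Arm \<open>j\<close> is optimal with mean \<open>x\<close> and all other means
      are zero, so each round that misses \<open>j\<close> costs exactly \<open>x\<close>.\<close>
    have reg: "regret S k (\<rho> j x) h = x * (T - pulls j h)" if "h \<in> set_pmf ?H" for h
    proof -
      have "(\<Sum>(a, r)\<leftarrow>h. x - Re (trace_mat (\<rho> j x * S a))) = x * (length h - pulls j h)"
        if "\<forall>(a, r)\<in>set h. a < k" for h
        using that
      proof (induction h)
        case (Cons y h)
        then show ?case by (auto simp: pulls_def mean[OF j] algebra_simps)
      qed (simp add: pulls_def)
      then show ?thesis
        using Max_eq set_hist_pmf[OF \<pi> that] by (simp add: regret_def)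
    qed
    \<comment> \<open>The construction yields the constant 1/12, which exceeds 3/100.\<close>
    have "3 / 100 * sqrt (n * T) \<le> sqrt (n * T) / 2 / 6"
      using n by simp
    also have "\<dots> = x * (T / 6)" using xT by simp
    also have "\<dots> \<le> x * (T - measure_pmf.expectation ?H (pulls j))"
      using pj x0 by (rule mult_left_mono)
    also have "\<dots> = measure_pmf.expectation ?H (\<lambda>h. x * (T - pulls j h))"
      using integrable_measure_pmf_finite[OF fin, of "pulls j"] by simp
    also have "\<dots> = expected_regret S k (\<rho> j x) \<pi> T"
      unfolding expected_regret_def using reg by (intro expectation_pmf_cong) simp
    finally show ?thesis
      using dens[OF j x0 x1] unfolding S_def d_def n_def by blast
  qed
qed

end
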